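(* Let $(G,\mu)$ be a measured group with Poisson boundary $(B,m)$ and suppose $(X,\nu)$ is an ergodic $(G,\check\mu)$-space. Then the diagonal $G$-action on the product space $(B\times X,\ m\otimes\nu)$ is ergodic.
   Context: A measured group $(G,\mu)$ is a countable group $G$ together with a probability measure $\mu$ on $G$ whose support generates $G$ as a semigroup; $\check\mu(g)=\mu(g^{-1})$. A $(G,\mu)$-space is a (standard) Borel probability space $(X,\nu)$ with an action of $G$ by bi-measurable maps, each preserving the measure class of $\nu$, such that $$\int_G\int_X\phi(g^{-1}x)\,d\nu(x)\,d\mu(g)=\int_X\phi\,d\nu\quad\text{for all }\phi\in L^\infty(X,\nu);$$ a $(G,\check\mu)$-space is defined in the same way with $\check\mu$ in place of $\mu$. An action of $G$ preserving the measure class of a probability measure is ergodic if every $G$-invariant measurable set is null or conull. The Poisson boundary of $(G,\mu)$ is an ergodic $(G,\mu)$-space $(B,m)$ for which the Poisson transform $P\phi(g)=\int_B\phi(g^{-1}b)\,dm(b)$, $g\in G$, is an isometric isomorphism of $L^\infty(B,m)$ onto the space (with supremum norm) of all bounded functions $f$ on $G$ satisfying $f(g)=\int_G f(sg)\,d\mu(s)$ for all $g\in G$. *)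

theory Defs
  imports "HOL-Probability.Probability" "HOL-Algebra.Group_Action"
begin

inductive_set semigroup_generated :: "('g, 'h) monoid_scheme \<Rightarrow> 'g set \<Rightarrow> 'g set"
  for G (structure) and S :: "'g set"
where
  incl: "s \<in> S \<Longrightarrow> s \<in> semigroup_generated G S"
| mult: "s \<in> semigroup_generated G S \<Longrightarrow> t \<in> semigroup_generated G S
    \<Longrightarrow> s \<otimes> t \<in> semigroup_generated G S"

locale measured_group = group G for G (structure) +
  fixes \<mu> :: "'a pmf"
  assumes countable_carrier: "countable (carrier G)"
    and support_subset: "set_pmf \<mu> \<subseteq> carrier G"
    and support_generates: "semigroup_generated G (set_pmf \<mu>) = carrier G"

definition reflected_pmf :: "('g, 'h) monoid_scheme \<Rightarrow> 'g pmf \<Rightarrow> 'g pmf"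
  where "reflected_pmf G \<mu> = map_pmf (\<lambda>g. inv\<^bsub>G\<^esub> g) \<mu>"

lemma (in measured_group) pmf_reflected_pmf:
  assumes "g \<in> carrier G"
  shows "pmf (reflected_pmf G \<mu>) g = pmf \<mu> (inv g)"
proof -
  have "pmf (reflected_pmf G \<mu>) g = measure \<mu> ((\<lambda>g. inv g) -` {g})"
    by (simp add: reflected_pmf_def pmf_map)
  also have "\<dots> = measure \<mu> ((\<lambda>g. inv g) -` {g} \<inter> set_pmf \<mu>)"
    by (simp add: measure_Int_set_pmf)
  also have "(\<lambda>g. inv g) -` {g} \<inter> set_pmf \<mu> = {inv g} \<inter> set_pmf \<mu>"
    using support_subset assms by auto
  also have "measure \<mu> ({inv g} \<inter> set_pmf \<mu>) = pmf \<mu> (inv g)"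
    by (simp only: measure_Int_set_pmf measure_pmf_single)
  finally show ?thesis .
qed

definition standard_borel :: "'a measure \<Rightarrow> bool"
  where "standard_borel M \<longleftrightarrow>
    (\<exists>T. topspace T = space M \<and> completely_metrizable_space T \<and> second_countable T
       \<and> sets M = sigma_sets (space M) {U. openin T U})"

text \<open>Each \<^term>\<open>\<phi> g\<close> is a bijection of the space with inverse the action of the inverse of
  \<^term>\<open>g\<close>, so measurability for all group elements makes every one of them bi-measurable.\<close>

locale nonsingular_action = group_action G "space M" \<phi> + prob_space M
  for G (structure) and M :: "'b measure" and \<phi> +
  assumes action_measurable: "g \<in> carrier G \<Longrightarrow> \<phi> g \<in> M \<rightarrow>\<^sub>M M"
    and preserves_measure_class:
      "g \<in> carrier G \<Longrightarrow> null_sets (distr M M (\<phi> g)) = null_sets M"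

locale ergodic_action = nonsingular_action +
  assumes ergodic: "A \<in> sets M \<Longrightarrow> (\<And>g. g \<in> carrier G \<Longrightarrow> \<phi> g ` A = A)
    \<Longrightarrow> A \<in> null_sets M \<or> space M - A \<in> null_sets M"

definition Linfty_norm :: "'b measure \<Rightarrow> ('b \<Rightarrow> real) \<Rightarrow> ereal"
  where "Linfty_norm M f = esssup M (\<lambda>x. ereal \<bar>f x\<bar>)"

text \<open>Elements are representatives, not classes modulo null sets.\<close>

definition Linfty :: "'b measure \<Rightarrow> ('b \<Rightarrow> real) set"
  where "Linfty M = {f \<in> borel_measurable M. Linfty_norm M f < \<infinity>}"

locale stationary_space = nonsingular_action G M \<phi>
  for G (structure) and \<mu> :: "'a pmf" and M :: "'b measure" and \<phi> +
  assumes standard_borel: "standard_borel M"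
    and stationary: "f \<in> Linfty M \<Longrightarrow>
      (\<integral>g. (\<integral>x. f (\<phi> (inv g) x) \<partial>M) \<partial>measure_pmf \<mu>) = (\<integral>x. f x \<partial>M)"

definition poisson_transform ::
    "('g, 'h) monoid_scheme \<Rightarrow> 'b measure \<Rightarrow> ('g \<Rightarrow> 'b \<Rightarrow> 'b) \<Rightarrow> ('b \<Rightarrow> real) \<Rightarrow> 'g \<Rightarrow> real"
  where "poisson_transform G M \<phi> f = (\<lambda>g\<in>carrier G. \<integral>b. f (\<phi> (inv\<^bsub>G\<^esub> g) b) \<partial>M)"

text \<open>Functions on the group are taken extensional, so that equality is equality on the carrier.\<close>

definition bounded_harmonic :: "('g, 'h) monoid_scheme \<Rightarrow> 'g pmf \<Rightarrow> ('g \<Rightarrow> real) set"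
  where "bounded_harmonic G \<mu> =
    {f \<in> extensional (carrier G). bounded (f ` carrier G) \<and>
       (\<forall>g\<in>carrier G. f g = (\<integral>s. f (s \<otimes>\<^bsub>G\<^esub> g) \<partial>measure_pmf \<mu>))}"

definition sup_norm :: "('g, 'h) monoid_scheme \<Rightarrow> ('g \<Rightarrow> real) \<Rightarrow> ereal"
  where "sup_norm G f = (SUP g\<in>carrier G. ereal \<bar>f g\<bar>)"

text \<open>Linearity of the transform is that of the integral, and it respects equality almost
  everywhere because the action is nonsingular; the isometry condition then gives injectivity
  modulo null sets, and the image condition gives surjectivity.\<close>

locale poisson_boundary = stationary_space G \<mu> M \<phi> + ergodic_action G M \<phi>
  for G (structure) and \<mu> :: "'a pmf" and M :: "'b measure" and \<phi> +
  assumes poisson_transform_isometric: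
      "f \<in> Linfty M \<Longrightarrow> sup_norm G (poisson_transform G M \<phi> f) = Linfty_norm M f"
    and poisson_transform_image:
      "poisson_transform G M \<phi> ` Linfty M = bounded_harmonic G \<mu>"

definition diagonal_action ::
    "'b measure \<Rightarrow> 'x measure \<Rightarrow> ('g \<Rightarrow> 'b \<Rightarrow> 'b) \<Rightarrow> ('g \<Rightarrow> 'x \<Rightarrow> 'x) \<Rightarrow> 'g \<Rightarrow> 'b \<times> 'x \<Rightarrow> 'b \<times> 'x"
  where "diagonal_action M N \<phi> \<psi> g = (\<lambda>(b, x)\<in>space M \<times> space N. (\<phi> g b, \<psi> g x))"

end

theory Submission
  imports Defs
begin

text \<open>Let \<open>A\<close> be an invariant subset of \<open>B \<times> X\<close> and let \<open>h x\<close> be the \<open>m\<close>-measure of its section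
  \<open>A\<^sub>x\<close>. Invariance of \<open>A\<close> says that \<open>g \<mapsto> h (g x)\<close> is the Poisson transform of the indicator of
  \<open>A\<^sub>x\<close>; in particular \<open>h x\<close> is the \<open>\<mu>\<close>-average of \<open>h (s x)\<close>. Since \<open>\<nu>\<close> is stationary for the
  reflected measure, averaging \<open>h\<^sup>2\<close> in this way does not change its integral, so expanding
  the mean square of \<open>h (s x) - h x\<close> shows that it vanishes and \<open>h\<close> is invariant, hence equal to a constant \<open>c\<close> almost everywhere.
  For almost every \<open>x\<close> the indicator of \<open>A\<^sub>x\<close> thus has the same Poisson transform as the constant
  \<open>c\<close>, and injectivity of the transform forces it to be \<open>c\<close> almost everywhere, so that
  \<open>c\<close> is 0 or 1.\<close>

section \<open>Actions that preserve null sets\<close>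

context nonsingular_action
begin

lemma group_G: "group G"
  using group_hom by (rule group_hom.axioms(1))

lemma action_closed: "g \<in> carrier G \<Longrightarrow> x \<in> space M \<Longrightarrow> \<phi> g x \<in> space M"
  using element_image by blast

lemma action_inv_cancel:
  assumes "g \<in> carrier G" "x \<in> space M"
  shows "\<phi> (inv g) (\<phi> g x) = x" "\<phi> g (\<phi> (inv g) x) = x"
  using assms orbit_sym_aux[of g x] orbit_sym_aux[of "inv g" x] group_G
  by (auto simp: group.inv_inv)

text \<open>The preimage under \<open>\<phi> g\<close> of an exceptional null set is again null,
  because the push-forward of \<open>M\<close> has the same null sets as \<open>M\<close>.\<close>

lemma AE_action:
  assumes g: "g \<in> carrier G" and P: "AE x in M. P x"
  shows "AE x in M. P (\<phi> g x)"
proof -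
  obtain N where N: "N \<in> null_sets M" "{x \<in> space M. \<not> P x} \<subseteq> N"
    using P by (auto simp: eventually_ae_filter)
  then have "N \<in> null_sets (distr M M (\<phi> g))"
    using preserves_measure_class[OF g] by simp
  then have "\<phi> g -` N \<inter> space M \<in> null_sets M"
    using null_sets_distr_iff[OF action_measurable[OF g]] by blast
  moreover have "{x \<in> space M. \<not> P (\<phi> g x)} \<subseteq> \<phi> g -` N \<inter> space M"
    using N(2) action_closed[OF g] by auto
  ultimately show ?thesis
    unfolding eventually_ae_filter by blast
qed

end

lemma bounded_measurable_in_Linfty:
  assumes [measurable]: "f \<in> borel_measurable M" and "\<And>x. x \<in> space M \<Longrightarrow> \<bar>f x\<bar> \<le> C"
  shows "f \<in> Linfty M"
proof -
  have "esssup M (\<lambda>x. ereal \<bar>f x\<bar>) \<le> ereal C"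
    using assms(2) by (intro esssup_I) auto
  then show ?thesis
    by (auto simp: Linfty_def Linfty_norm_def intro: le_less_trans)
qed

lemma AE_eq_0_if_Linfty_norm_eq_0:
  assumes "Linfty_norm M f = 0"
  shows "AE x in M. f x = 0"
  using esssup_AE[where M = M and f = "\<lambda>x. ereal \<bar>f x\<bar>"] assms
  by (auto simp: Linfty_norm_def zero_ereal_def)

section \<open>The diagonal action on a product\<close>

lemma group_action_diagonal:
  fixes G (structure)
  assumes "nonsingular_action G M \<phi>" "nonsingular_action G N \<psi>"
  shows "group_action G (space (M \<Otimes>\<^sub>M N)) (diagonal_action M N \<phi> \<psi>)"
proof -
  interpret M: nonsingular_action G M \<phi> by fact
  interpret N: nonsingular_action G N \<psi> by fact
  interpret group G by (rule M.group_G)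
  let ?E = "space (M \<Otimes>\<^sub>M N)" and ?D = "diagonal_action M N \<phi> \<psi>"
  have E: "?E = space M \<times> space N"
    by (simp add: space_pair_measure)
  have bij: "?D g \<in> Bij ?E" if g: "g \<in> carrier G" for g
  proof -
    have "bij_betw (?D g) ?E ?E"
      using g by (intro bij_betwI[where g = "?D (inv g)"])
        (auto simp: diagonal_action_def E M.action_closed N.action_closed
          M.action_inv_cancel N.action_inv_cancel)
    then show ?thesis
      by (auto simp: Bij_def diagonal_action_def E)
  qed
  have "?D (g \<otimes> h) = compose ?E (?D g) (?D h)" if "g \<in> carrier G" "h \<in> carrier G" for g h
    using that by (auto simp: fun_eq_iff compose_def diagonal_action_def E restrict_def
        M.action_closed N.action_closed M.composition_rule N.composition_rule)
  then have "?D \<in> hom G (BijGroup ?E)"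
    using bij by (auto simp: hom_def BijGroup_def)
  then show ?thesis
    by (simp add: group_action_def group_hom_def group_hom_axioms_def group_BijGroup is_group)
qed

text \<open>By Fubini a product null set is one with almost all sections null. This condition
  survives moving one coordinate at a time, so nonsingularity of each factor suffices.\<close>

lemma nonsingular_action_diagonal:
  fixes G (structure)
  assumes "nonsingular_action G M \<phi>" "nonsingular_action G N \<psi>"
  shows "nonsingular_action G (M \<Otimes>\<^sub>M N) (diagonal_action M N \<phi> \<psi>)"
proof -
  interpret M: nonsingular_action G M \<phi> by fact
  interpret N: nonsingular_action G N \<psi> by fact
  interpret P: pair_prob_space M N ..
  interpret group G by (rule M.group_G)
  let ?D = "diagonal_action M N \<phi> \<psi>"
  interpret D: group_action G "space (M \<Otimes>\<^sub>M N)" ?D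
    by (rule group_action_diagonal[OF assms])
  have meas: "?D g \<in> M \<Otimes>\<^sub>M N \<rightarrow>\<^sub>M M \<Otimes>\<^sub>M N" if g: "g \<in> carrier G" for g
  proof -
    note [measurable] = M.action_measurable[OF g] N.action_measurable[OF g]
    have "(\<lambda>p. (\<phi> g (fst p), \<psi> g (snd p))) \<in> M \<Otimes>\<^sub>M N \<rightarrow>\<^sub>M M \<Otimes>\<^sub>M N"
      by measurable
    then show ?thesis
      by (rule measurable_cong[THEN iffD1, rotated])
        (auto simp: diagonal_action_def space_pair_measure)
  qed
  have null: "?D g -` A \<inter> space (M \<Otimes>\<^sub>M N) \<in> null_sets (M \<Otimes>\<^sub>M N)"
    if g: "g \<in> carrier G" and A: "A \<in> null_sets (M \<Otimes>\<^sub>M N)" for g A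
  proof -
    define A' where "A' = ?D g -` A \<inter> space (M \<Otimes>\<^sub>M N)"
    have A' [measurable]: "A' \<in> sets (M \<Otimes>\<^sub>M N)"
      unfolding A'_def using A meas[OF g] by (auto intro: measurable_sets)
    have "AE p in M \<Otimes>\<^sub>M N. p \<notin> A"
      using A by (rule AE_not_in)
    then have "AE x in M. AE y in N. (x, y) \<notin> A"
      by (rule P.AE_pair)
    then have "AE x in M. AE y in N. (\<phi> g x, y) \<notin> A"
      by (rule M.AE_action[OF g])
    then have "AE x in M. AE y in N. (\<phi> g x, \<psi> g y) \<notin> A"
      by eventually_elim (rule N.AE_action[OF g])
    then have "AE x in M. AE y in N. (x, y) \<notin> A'"
      using AE_space
    proof eventually_elim
      case (elim x)
      from elim(1) AE_space show ?case
        by eventually_elim (simp add: A'_def diagonal_action_def elim(2))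
    qed
    then have "AE p in M \<Otimes>\<^sub>M N. p \<notin> A'"
      by (rule P.AE_pair_measure[rotated]) measurable
    then show ?thesis
      unfolding A'_def[symmetric] using AE_iff_null_sets[OF A'] by blast
  qed
  have "null_sets (distr (M \<Otimes>\<^sub>M N) (M \<Otimes>\<^sub>M N) (?D g)) = null_sets (M \<Otimes>\<^sub>M N)"
    if g: "g \<in> carrier G" for g
  proof (intro equalityI subsetI)
    fix A assume "A \<in> null_sets (distr (M \<Otimes>\<^sub>M N) (M \<Otimes>\<^sub>M N) (?D g))"
    then have A: "?D g -` A \<inter> space (M \<Otimes>\<^sub>M N) \<in> null_sets (M \<Otimes>\<^sub>M N)" "A \<in> sets (M \<Otimes>\<^sub>M N)"
      using null_sets_distr_iff[OF meas[OF g]] by blast+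
    \<comment> \<open>\<open>null\<close> only passes from a set to its preimage. For the converse,
      \<open>A\<close> is recovered as the preimage under \<open>?D (inv g)\<close> of its own
      preimage under \<open>?D g\<close>.\<close>
    have cancel: "?D (inv g) p \<in> space (M \<Otimes>\<^sub>M N) \<and> ?D g (?D (inv g) p) = p"
      if "p \<in> space (M \<Otimes>\<^sub>M N)" for p
      using D.element_image[OF inv_closed[OF g] that refl]
        D.orbit_sym_aux[OF inv_closed[OF g] that refl] inv_inv[OF g] by metis
    have "?D (inv g) -` (?D g -` A \<inter> space (M \<Otimes>\<^sub>M N)) \<inter> space (M \<Otimes>\<^sub>M N)
        = A \<inter> space (M \<Otimes>\<^sub>M N)"
    proof (rule Set.set_eqI)
      show "p \<in> ?D (inv g) -` (?D g -` A \<inter> space (M \<Otimes>\<^sub>M N)) \<inter> space (M \<Otimes>\<^sub>M N)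
          \<longleftrightarrow> p \<in> A \<inter> space (M \<Otimes>\<^sub>M N)" for p
        using cancel[of p] by (cases "p \<in> space (M \<Otimes>\<^sub>M N)") simp_all
    qed
    also have "\<dots> = A"
      using A(2) by (rule sets.Int_space_eq2)
    finally show "A \<in> null_sets (M \<Otimes>\<^sub>M N)"
      using null[OF inv_closed[OF g] A(1)] by metis
  next
    fix A assume "A \<in> null_sets (M \<Otimes>\<^sub>M N)"
    then show "A \<in> null_sets (distr (M \<Otimes>\<^sub>M N) (M \<Otimes>\<^sub>M N) (?D g))"
      using null[OF g] null_setsD2 null_sets_distr_iff[OF meas[OF g]] by blast
  qed
  with meas show ?thesis
    by (intro nonsingular_action.intro nonsingular_action_axioms.intro D.group_action_axioms
        P.P.prob_space_axioms)
qed

section \<open>Almost invariant functions under an ergodic action\<close>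

text \<open>Ergodicity gives a zero-one law for the events \<open>Q (h x)\<close>, and no integrable
  function lies almost everywhere strictly on one side of its mean.\<close>

lemma (in ergodic_action) AE_invariant_imp_AE_const:
  fixes h :: "'c \<Rightarrow> real"
  assumes "countable (carrier G)" and int: "integrable M h"
    and inv: "\<And>g. g \<in> carrier G \<Longrightarrow> AE x in M. h (\<phi> g x) = h x"
  shows "AE x in M. h x = expectation h"
proof -
  interpret group G by (rule group_G)
  have [measurable]: "h \<in> borel_measurable M"
    using int by auto
  note [measurable] = action_measurable
  \<comment> \<open>\<open>ergodic\<close> speaks of exactly invariant sets, whereas
    \<open>h\<close> is invariant only up to a null set for each \<open>g\<close>. On the set
    \<open>X0\<close>, conull because the group is countable, the invariance is exact.\<close>
  define X0 where "X0 = {x \<in> space M. \<forall>g\<in>carrier G. h (\<phi> g x) = h x}"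
  have X0 [measurable]: "X0 \<in> sets M"
    unfolding X0_def using assms(1) by measurable
  have AE_X0: "AE x in M. x \<in> X0"
    using AE_ball_countable[OF assms(1), of "\<lambda>x g. h (\<phi> g x) = h x" M] inv
    by (auto simp: X0_def)
  have X0_act: "\<phi> g x \<in> X0 \<and> h (\<phi> g x) = h x" if "g \<in> carrier G" "x \<in> X0" for g x
    using that unfolding X0_def
    by (auto simp: action_closed composition_rule[symmetric])
  have dichotomy: "(AE x in M. \<not> Q (h x)) \<or> (AE x in M. Q (h x))"
    if [measurable]: "Measurable.pred borel Q" for Q
  proof -
    let ?A = "{x \<in> X0. Q (h x)}"
    have A: "?A \<in> sets M"
    proof -
      have "?A = {x \<in> space M. x \<in> X0 \<and> Q (h x)}"
        using sets.sets_into_space[OF X0] by auto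
      then show ?thesis by simp
    qed
    have "\<phi> g ` ?A = ?A" if g: "g \<in> carrier G" for g
    proof safe
      fix x assume x: "x \<in> X0" "Q (h x)"
      show "\<phi> g x \<in> X0" "Q (h (\<phi> g x))"
        using X0_act[OF g x(1)] x(2) by auto
      have "x = \<phi> g (\<phi> (inv g) x)"
        using g x by (simp add: action_inv_cancel X0_def)
      moreover have "\<phi> (inv g) x \<in> ?A"
        using X0_act[OF inv_closed[OF g] x(1)] x(2) by auto
      ultimately show "x \<in> \<phi> g ` ?A"
        by blast
    qed
    then have "?A \<in> null_sets M \<or> space M - ?A \<in> null_sets M"
      by (rule ergodic[OF A])
    then show ?thesis
    proof
      assume "?A \<in> null_sets M"
      from AE_not_in[OF this] AE_X0 have "AE x in M. \<not> Q (h x)"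
        by eventually_elim auto
      then show ?thesis ..
    next
      assume "space M - ?A \<in> null_sets M"
      from AE_not_in[OF this] AE_space have "AE x in M. Q (h x)"
        by eventually_elim auto
      then show ?thesis ..
    qed
  qed
  have "\<not> (AE x in M. h x < expectation h)"
    using expectation_less[OF int] by blast
  then have "AE x in M. \<not> h x < expectation h"
    using dichotomy[of "\<lambda>y. y < expectation h"] by auto
  moreover have "\<not> (AE x in M. h x > expectation h)"
    using expectation_greater[OF int] by blast
  then have "AE x in M. \<not> h x > expectation h"
    using dichotomy[of "\<lambda>y. y > expectation h"] by auto
  ultimately show ?thesis
    by eventually_elim auto
qed

section \<open>Harmonic functions on a stationary space\<close>

text \<open>The squared \<open>L^2\<close> distance between \<open>h\<close> and its translate by
  \<open>s\<close> has \<open>\<mu>\<close>-mean zero: stationarity evaluates the square terms,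
  harmonicity the cross term, and they cancel. Hence translates by the support of
  \<open>\<mu>\<close> fix \<open>h\<close> almost everywhere, and the support generates the group
  as a semigroup.\<close>

lemma harmonic_imp_AE_invariant:
  fixes G (structure) and h :: "'x \<Rightarrow> real"
  assumes "measured_group G \<mu>" "stationary_space G (reflected_pmf G \<mu>) X \<xi>"
    and h [measurable]: "h \<in> borel_measurable X"
    and bound: "\<And>x. x \<in> space X \<Longrightarrow> \<bar>h x\<bar> \<le> C"
    and harm: "\<And>x. x \<in> space X \<Longrightarrow> h x = (\<integral>s. h (\<xi> s x) \<partial>measure_pmf \<mu>)"
    and g: "g \<in> carrier G"
  shows "AE x in X. h (\<xi> g x) = h x"
proof -
  interpret measured_group G \<mu> by fact
  interpret X: stationary_space G "reflected_pmf G \<mu>" X \<xi> by fact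
  note [measurable] = X.action_measurable
  interpret P: pair_prob_space "measure_pmf \<mu>" X ..
  \<comment> \<open>Redefined outside the carrier, the action becomes jointly measurable on \<open>\<mu> \<otimes> X\<close>.\<close>
  define k where "k s = (if s \<in> carrier G then s else \<one>)" for s
  have k: "k s \<in> carrier G" for s
    by (simp add: k_def)
  have kS: "k s = s" if "s \<in> set_pmf \<mu>" for s
    using that support_subset by (auto simp: k_def)
  have C: "0 \<le> C"
    using X.not_empty bound by (meson abs_ge_zero ex_in_conv order_trans)
  have bound': "\<bar>h (\<xi> (k s) x)\<bar> \<le> C" if "x \<in> space X" for s x
    using that k by (intro bound X.action_closed)
  have mk [measurable]: "\<xi> (k s) \<in> X \<rightarrow>\<^sub>M X" for s
    using k by (rule X.action_measurable)
  have "(\<lambda>p. h (\<xi> (k (fst p)) (snd p))) \<in> borel_measurable (measure_pmf \<mu> \<Otimes>\<^sub>M X)"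
  proof (rule measurable_compose_countable'[where f = "\<lambda>s p. h (\<xi> s (snd p))", OF _ _ countable_carrier])
    show "(\<lambda>p. k (fst p)) \<in> measure_pmf \<mu> \<Otimes>\<^sub>M X \<rightarrow>\<^sub>M count_space (carrier G)"
      by (rule measurable_compose[OF measurable_fst]) (simp add: measurable_def k)
  qed measurable
  then have joint [measurable]:
      "(\<lambda>(s, x). h (\<xi> (k s) x)) \<in> borel_measurable (measure_pmf \<mu> \<Otimes>\<^sub>M X)"
    by (simp add: case_prod_beta)
  \<comment> \<open>The inverse in \<open>stationary\<close> and the one in
    \<open>reflected_pmf\<close> cancel, so the average is over \<open>s\<close> itself with weight
    \<open>\<mu>\<close>.\<close>
  have stat: "(\<integral>s. (\<integral>x. f (\<xi> (k s) x) \<partial>X) \<partial>measure_pmf \<mu>) = (\<integral>x. f x \<partial>X)"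
    if "f \<in> Linfty X" for f
  proof -
    have "(\<integral>s. (\<integral>x. f (\<xi> (k s) x) \<partial>X) \<partial>measure_pmf \<mu>)
        = (\<integral>s. (\<integral>x. f (\<xi> (inv (inv s)) x) \<partial>X) \<partial>measure_pmf \<mu>)"
      using support_subset by (intro integral_cong_AE) (auto simp: AE_measure_pmf_iff kS subsetD)
    also have "\<dots> = (\<integral>x. f x \<partial>X)"
      using X.stationary[OF that] by (simp add: reflected_pmf_def)
    finally show ?thesis .
  qed
  have b2: "(h (\<xi> (k s) x))\<^sup>2 \<le> C\<^sup>2" "(h x)\<^sup>2 \<le> C\<^sup>2" "\<bar>h (\<xi> (k s) x) * h x\<bar> \<le> C\<^sup>2"
    if "x \<in> space X" for s x
  proof -
    show "(h (\<xi> (k s) x))\<^sup>2 \<le> C\<^sup>2" "(h x)\<^sup>2 \<le> C\<^sup>2"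
      using bound[OF that] bound'[OF that] C by (simp_all only: power2_le_iff_abs_le)
    show "\<bar>h (\<xi> (k s) x) * h x\<bar> \<le> C\<^sup>2"
      unfolding abs_mult power2_eq_square
      by (intro mult_mono bound[OF that] bound'[OF that] C abs_ge_zero)
  qed
  have int [simp]: "integrable X (\<lambda>x. (h x)\<^sup>2)"
    "integrable X (\<lambda>x. (h (\<xi> (k s) x))\<^sup>2)" "integrable X (\<lambda>x. h (\<xi> (k s) x) * h x)" for s
    using b2 by (auto intro!: X.integrable_const_bound[where B = "C\<^sup>2"] AE_I2)
  have bdd: "integrable (measure_pmf \<mu>) (\<lambda>s. \<integral>x. f s x \<partial>X)"
    if "\<And>s. integrable X (f s)" "\<And>s x. x \<in> space X \<Longrightarrow> \<bar>f s x\<bar> \<le> D" for f :: "_ \<Rightarrow> _ \<Rightarrow> real" and D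
  proof (rule measure_pmf.integrable_const_bound[where B = D])
    have "\<bar>\<integral>x. f s x \<partial>X\<bar> \<le> D" for s
    proof -
      have "\<bar>\<integral>x. f s x \<partial>X\<bar> \<le> (\<integral>x. \<bar>f s x\<bar> \<partial>X)"
        by (rule integral_abs_bound)
      also have "\<dots> \<le> D"
        using that by (intro X.integral_le_const) auto
      finally show ?thesis .
    qed
    then show "AE s in measure_pmf \<mu>. norm (\<integral>x. f s x \<partial>X) \<le> D"
      by simp
  qed simp
  have sq: "(\<integral>s. (\<integral>x. (h (\<xi> (k s) x))\<^sup>2 \<partial>X) \<partial>measure_pmf \<mu>) = (\<integral>x. (h x)\<^sup>2 \<partial>X)"
    using b2 by (intro stat bounded_measurable_in_Linfty[where C = "C\<^sup>2"]) auto
  have "integrable (measure_pmf \<mu> \<Otimes>\<^sub>M X) (\<lambda>(s, x). h (\<xi> (k s) x) * h x)"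
    using b2 by (intro P.P.integrable_const_bound[where B = "C\<^sup>2"] AE_I2)
      (auto simp: space_pair_measure)
  \<comment> \<open>With \<open>s\<close> as the inner variable, the factor \<open>h x\<close> comes
    out and harmonicity turns the remaining mean into a second \<open>h x\<close>.\<close>
  from P.Fubini_integral[OF this]
  have "(\<integral>s. (\<integral>x. h (\<xi> (k s) x) * h x \<partial>X) \<partial>measure_pmf \<mu>)
      = (\<integral>x. (\<integral>s. h (\<xi> (k s) x) * h x \<partial>measure_pmf \<mu>) \<partial>X)"
    by simp
  also have "\<dots> = (\<integral>x. (h x)\<^sup>2 \<partial>X)"
  proof (rule Bochner_Integration.integral_cong[OF refl])
    fix x assume x: "x \<in> space X"
    have "(\<integral>s. h (\<xi> (k s) x) \<partial>measure_pmf \<mu>) = (\<integral>s. h (\<xi> s x) \<partial>measure_pmf \<mu>)"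
      by (intro integral_cong_AE) (auto simp: AE_measure_pmf_iff kS)
    then show "(\<integral>s. h (\<xi> (k s) x) * h x \<partial>measure_pmf \<mu>) = (h x)\<^sup>2"
      using harm[OF x] by (simp add: power2_eq_square)
  qed
  finally have cross: "(\<integral>s. (\<integral>x. h (\<xi> (k s) x) * h x \<partial>X) \<partial>measure_pmf \<mu>) = (\<integral>x. (h x)\<^sup>2 \<partial>X)" .
  define V where "V s = (\<integral>x. (h (\<xi> (k s) x) - h x)\<^sup>2 \<partial>X)" for s
  have intV: "integrable X (\<lambda>x. (h (\<xi> (k s) x) - h x)\<^sup>2)" for s
    using int by (simp add: power2_diff mult.assoc)
  have V_eq: "V s = (\<integral>x. (h (\<xi> (k s) x))\<^sup>2 \<partial>X) + (\<integral>x. (h x)\<^sup>2 \<partial>X)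
      - 2 * (\<integral>x. h (\<xi> (k s) x) * h x \<partial>X)" for s
    unfolding V_def using int by (simp add: power2_diff mult.assoc)
  have i1: "integrable (measure_pmf \<mu>) (\<lambda>s. \<integral>x. (h (\<xi> (k s) x))\<^sup>2 \<partial>X)"
    using b2 by (intro bdd[of _ "C\<^sup>2"]) auto
  have i2: "integrable (measure_pmf \<mu>) (\<lambda>s. \<integral>x. h (\<xi> (k s) x) * h x \<partial>X)"
    using b2 by (intro bdd[of _ "C\<^sup>2"]) auto
  have "(\<integral>s. V s \<partial>measure_pmf \<mu>) = 0"
    unfolding V_eq using i1 i2 by (simp add: sq cross)
  moreover have "integrable (measure_pmf \<mu>) V"
    unfolding V_eq[abs_def] using i1 i2 by simp
  moreover have "0 \<le> V s" for s
    by (simp add: V_def)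
  ultimately have "AE s in measure_pmf \<mu>. V s = 0"
    by (subst (asm) integral_nonneg_eq_0_iff_AE) auto
  \<comment> \<open>For a discrete measure, almost every \<open>s\<close> means every
    \<open>s\<close> of positive mass.\<close>
  then have support: "AE x in X. h (\<xi> s x) = h x" if "s \<in> set_pmf \<mu>" for s
    using that integral_nonneg_eq_0_iff_AE[OF intV, of s] by (auto simp: AE_measure_pmf_iff V_def kS)
  have "g \<in> semigroup_generated G (set_pmf \<mu>)"
    using g support_generates by simp
  then show ?thesis
  proof induction
    case (incl s)
    then show ?case by (rule support)
  next
    case (mult s t)
    then have st: "s \<in> carrier G" "t \<in> carrier G"
      using support_generates by auto
    \<comment> \<open>Invariance under \<open>s\<close> is used at the point
      \<open>\<xi> t x\<close>; nonsingularity of \<open>t\<close> keeps the exceptional set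
      null.\<close>
    have "AE x in X. h (\<xi> s (\<xi> t x)) = h (\<xi> t x)"
      using mult.IH(1) by (rule X.AE_action[OF st(2)])
    with mult.IH(2) AE_space show ?case
      by eventually_elim (simp add: X.composition_rule st)
  qed
qed

section \<open>Ergodicity of the product with the Poisson boundary\<close>

theorem theorem2p3:
  fixes G :: "('g, 'h) monoid_scheme" and \<mu> :: "'g pmf"
    and B :: "'b measure" and \<beta> :: "'g \<Rightarrow> 'b \<Rightarrow> 'b"
    and X :: "'x measure" and \<xi> :: "'g \<Rightarrow> 'x \<Rightarrow> 'x"
  assumes "measured_group G \<mu>"
    and "poisson_boundary G \<mu> B \<beta>"
    and "stationary_space G (reflected_pmf G \<mu>) X \<xi>"
    and "ergodic_action G X \<xi>"
  shows "ergodic_action G (B \<Otimes>\<^sub>M X) (diagonal_action B X \<beta> \<xi>)"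
proof -
  interpret measured_group G \<mu> by fact
  interpret B: poisson_boundary G \<mu> B \<beta> by fact
  interpret X: stationary_space G "reflected_pmf G \<mu>" X \<xi> by fact
  interpret X: ergodic_action G X \<xi> by fact
  interpret P: pair_prob_space B X ..
  let ?D = "diagonal_action B X \<beta> \<xi>"
  interpret D: nonsingular_action G "B \<Otimes>\<^sub>M X" ?D
    by (rule nonsingular_action_diagonal) unfold_locales
  show ?thesis
  proof (unfold_locales)
    fix A assume A [measurable]: "A \<in> sets (B \<Otimes>\<^sub>M X)"
      and inv_A: "\<And>g. g \<in> carrier G \<Longrightarrow> ?D g ` A = A"
    have A_sub: "A \<subseteq> space B \<times> space X"
      using sets.sets_into_space[OF A] by (simp add: space_pair_measure)
    have D_A: "(\<beta> g b, \<xi> g x) \<in> A" if "g \<in> carrier G" "(b, x) \<in> A" for g b x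
    proof -
      have "?D g (b, x) \<in> A"
        using inv_A[OF that(1)] that(2) by blast
      then show ?thesis
        using that A_sub by (auto simp: diagonal_action_def)
    qed
    define F where "F x b = (indicator A (b, x) :: real)" for x b
    define h where "h x = (\<integral>b. F x b \<partial>B)" for x
    \<comment> \<open>Applying \<open>g\<close> or its inverse to a point of the invariant set
      \<open>A\<close> trades a translation of \<open>x\<close> for the inverse translation of
      \<open>b\<close>.\<close>
    have F_equiv: "F (\<xi> g x) b = F x (\<beta> (inv\<^bsub>G\<^esub> g) b)"
      if g: "g \<in> carrier G" and "x \<in> space X" "b \<in> space B" for g x b
    proof -
      have "(b, \<xi> g x) \<in> A \<longleftrightarrow> (\<beta> (inv\<^bsub>G\<^esub> g) b, x) \<in> A"
        using D_A[OF g, of "\<beta> (inv\<^bsub>G\<^esub> g) b" x] D_A[of "inv\<^bsub>G\<^esub> g" b "\<xi> g x"] that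
        by (auto simp: B.action_inv_cancel X.action_inv_cancel)
      then show ?thesis
        by (simp add: F_def indicator_def)
    qed
    have F_meas [measurable]: "F x \<in> borel_measurable B" if "x \<in> space X" for x
      unfolding F_def[abs_def] using that by measurable
    have F_bound: "\<bar>F x b\<bar> \<le> 1" for x b
      by (simp add: F_def indicator_def)
    have F_int: "integrable B (F x)" if "x \<in> space X" for x
      using that F_bound by (intro B.integrable_const_bound[where B = 1]) auto
    have h_meas: "h \<in> borel_measurable X"
      unfolding h_def[abs_def] F_def[abs_def] by measurable
    have h_bound: "\<bar>h x\<bar> \<le> 1" if "x \<in> space X" for x
    proof -
      have "\<bar>h x\<bar> \<le> (\<integral>b. \<bar>F x b\<bar> \<partial>B)"
        unfolding h_def by (rule integral_abs_bound)
      also have "\<dots> \<le> 1"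
        using F_int[OF that] F_bound by (intro B.integral_le_const) auto
      finally show ?thesis .
    qed
    have h_transform: "h (\<xi> g x) = (\<integral>b. F x (\<beta> (inv\<^bsub>G\<^esub> g) b) \<partial>B)"
      if "g \<in> carrier G" "x \<in> space X" for g x
      unfolding h_def using F_equiv[OF that] by (intro Bochner_Integration.integral_cong) auto
    \<comment> \<open>By \<open>h_transform\<close> the right side averages translates of
      \<open>F x\<close>, so this is stationarity of the boundary applied to
      \<open>F x\<close>.\<close>
    have h_harmonic: "h x = (\<integral>s. h (\<xi> s x) \<partial>measure_pmf \<mu>)" if x: "x \<in> space X" for x
    proof -
      have "(\<integral>s. h (\<xi> s x) \<partial>measure_pmf \<mu>) = (\<integral>s. (\<integral>b. F x (\<beta> (inv\<^bsub>G\<^esub> s) b) \<partial>B) \<partial>measure_pmf \<mu>)"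
        using support_subset x
        by (intro integral_cong_AE) (auto simp: AE_measure_pmf_iff h_transform subsetD)
      also have "\<dots> = h x"
        unfolding h_def using x F_bound
        by (intro B.stationary bounded_measurable_in_Linfty[where C = 1]) auto
      finally show ?thesis by simp
    qed
    have h_inv: "AE x in X. h (\<xi> g x) = h x" if "g \<in> carrier G" for g
      using harmonic_imp_AE_invariant[OF assms(1,3) h_meas h_bound h_harmonic that] .
    define c where "c = (\<integral>x. h x \<partial>X)"
    have "integrable X h"
      using h_meas h_bound by (intro X.integrable_const_bound[where B = 1]) auto
    then have h_const: "AE x in X. h x = c"
      unfolding c_def using h_inv by (rule X.AE_invariant_imp_AE_const[OF countable_carrier])
    \<comment> \<open>The Poisson transform of a single \<open>F x\<close> involves every
      \<open>g\<close>, so one null set has to serve them all; countability of the group provides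
      it.\<close>
    have "AE x in X. \<forall>g\<in>carrier G. h (\<xi> g x) = c"
      using X.AE_action[OF _ h_const] by (intro AE_ball_countable'[OF _ countable_carrier])
    then have F_const: "AE x in X. AE b in B. F x b = c"
      using AE_space
    proof eventually_elim
      case (elim x)
      note [measurable] = F_meas[OF elim(2)] B.action_measurable
      have "\<bar>F x b - c\<bar> \<le> 1 + \<bar>c\<bar>" for b
        using F_bound[of x b] by linarith
      then have L: "(\<lambda>b. F x b - c) \<in> Linfty B"
        by (intro bounded_measurable_in_Linfty) auto
      \<comment> \<open>The transform of \<open>F x\<close> at \<open>g\<close> is
        \<open>h (\<xi> g x) = c\<close>, and that of the constant \<open>c\<close> is
        \<open>c\<close> because \<open>B\<close> has total mass one.\<close>
      have "poisson_transform G B \<beta> (\<lambda>b. F x b - c) g = 0" if g: "g \<in> carrier G" for g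
      proof -
        have [measurable]: "\<beta> (inv\<^bsub>G\<^esub> g) \<in> B \<rightarrow>\<^sub>M B"
          using g by (intro B.action_measurable) simp
        have "integrable B (\<lambda>b. F x (\<beta> (inv\<^bsub>G\<^esub> g) b))"
          using F_bound by (intro B.integrable_const_bound[where B = 1]) auto
        then show ?thesis
          using g elim h_transform[OF g elim(2)]
          by (simp add: poisson_transform_def B.prob_space)
      qed
      then have "sup_norm G (poisson_transform G B \<beta> (\<lambda>b. F x b - c)) = 0"
        unfolding sup_norm_def using carrier_not_empty
        by (subst SUP_cong[OF refl, where D = "\<lambda>_. 0"]) auto
      then have "Linfty_norm B (\<lambda>b. F x b - c) = 0"
        using B.poisson_transform_isometric[OF L] by simp
      then show "AE b in B. F x b = c"
        by (auto dest: AE_eq_0_if_Linfty_norm_eq_0)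
    qed
    \<comment> \<open>An indicator takes only the values 0 and 1. As the resulting condition on
      \<open>c\<close> involves neither variable and both spaces are probability spaces, it holds
      outright.\<close>
    then have "AE x in X. AE b in B. c = 0 \<or> c = 1"
    proof eventually_elim
      case (elim x)
      then show ?case
        by eventually_elim (auto simp: F_def indicator_def split: if_splits)
    qed
    then have c: "c = 0 \<or> c = 1"
      by simp
    \<comment> \<open>The sections so far are over \<open>x\<close>, while the product criterion for
      null sets has \<open>b\<close> as its outer variable; hence the exchange of
      quantifiers.\<close>
    have null: "S \<in> null_sets (B \<Otimes>\<^sub>M X)"
      if S [measurable]: "S \<in> sets (B \<Otimes>\<^sub>M X)" and AE: "AE x in X. AE b in B. (b, x) \<notin> S" for S
    proof -
      have "AE b in B. AE x in X. (b, x) \<notin> S"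
        using AE by (subst P.AE_commute) simp_all
      then have "AE p in B \<Otimes>\<^sub>M X. p \<notin> S"
        by (rule P.AE_pair_measure[rotated]) measurable
      then show ?thesis
        using S by (simp add: AE_iff_null_sets)
    qed
    from c show "A \<in> null_sets (B \<Otimes>\<^sub>M X) \<or> space (B \<Otimes>\<^sub>M X) - A \<in> null_sets (B \<Otimes>\<^sub>M X)"
    proof
      assume "c = 0"
      then have "AE x in X. AE b in B. (b, x) \<notin> A"
        using F_const by (simp add: F_def indicator_eq_0_iff)
      then show ?thesis
        using null[OF A] by blast
    next
      assume "c = 1"
      from F_const have "AE x in X. AE b in B. (b, x) \<notin> space (B \<Otimes>\<^sub>M X) - A"
      proof eventually_elim
        case (elim x)
        then show ?case
          by eventually_elim (simp add: F_def \<open>c = 1\<close> indicator_eq_1_iff)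
      qed
      then show ?thesis
        using null[of "space (B \<Otimes>\<^sub>M X) - A"] by auto
    qed
  qed
qed

end
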